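(* Let $A\in\mathbb{C}^{n\times p}$ and $b\in\mathbb{R}^n$. If $A$ is injective, $b_i\neq 0$ for all $i=1,\ldots,n$, and there exists $x\in\mathbb{C}^p$ with $|Ax|=b$ (entrywise modulus), then PhaseCutMod is tight whenever PhaseLift is tight.
   Context: $\mathbf{H}_k$ denotes the set of $k\times k$ complex Hermitian matrices; $X\succeq 0$ means $X$ is positive semidefinite; $A^\dagger$ is the Moore-Penrose pseudoinverse of $A$ and $A^{\dagger *}=(A^\dagger)^*$; $\mathrm{diag}(b)$ is the diagonal matrix with diagonal $b$, while for a matrix $U$, $\mathrm{diag}(U)$ is the vector of its diagonal entries. The row vector $a_i^*$ (with $a_i\in\mathbb{C}^p$) is the $i$-th row of $A$. PhaseLift is the semidefinite program: minimize $\mathrm{Tr}(X)$ over $X\in\mathbf{H}_p$ subject to $\mathrm{Tr}(a_ia_i^*X)=b_i^2$ for $i=1,\ldots,n$ and $X\succeq 0$. PhaseCutMod is the semidefinite program: minimize $\mathrm{Tr}(BU)$ over $U\in\mathbf{H}_n$ subject to $\mathrm{Tr}(MU)=0$, $\mathrm{diag}(U)=1$ (all diagonal entries equal to one) and $U\succeq 0$, where $M=\mathrm{diag}(b)(\mathbf{I}-AA^\dagger)\mathrm{diag}(b)$ and $B=\mathrm{diag}(b)A^{\dagger *}A^\dagger\mathrm{diag}(b)$. Either program is called tight if it has a unique optimal solution and this solution has rank one. *)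

theory Defs
  imports "HOL-Analysis.Analysis"
begin

definition conj_transpose :: "complex^'n^'m \<Rightarrow> complex^'m^'n" where
  "conj_transpose A = (\<chi> i j. cnj (A $ j $ i))"

definition hermitian :: "complex^'n^'n \<Rightarrow> bool" where
  "hermitian X \<longleftrightarrow> conj_transpose X = X"

text \<open>The quadratic form \<open>v\<^sup>* X v\<close> of a Hermitian matrix is real, so taking the real part
  loses nothing.\<close>

definition psd :: "complex^'n^'n \<Rightarrow> bool" where
  "psd X \<longleftrightarrow> hermitian X \<and> (\<forall>v. 0 \<le> Re (\<Sum>i\<in>UNIV. cnj (v $ i) * (X *v v) $ i))"

definition diag_matrix :: "real^'n \<Rightarrow> complex^'n^'n" where
  "diag_matrix b = (\<chi> i j. if i = j then complex_of_real (b $ i) else 0)"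

definition outer :: "complex^'n \<Rightarrow> complex^'n^'n" where
  "outer a = (\<chi> i j. a $ i * cnj (a $ j))"

text \<open>The Moore--Penrose pseudoinverse is the unique matrix satisfying the four Penrose equations.\<close>

definition is_pseudoinverse :: "complex^'n^'m \<Rightarrow> complex^'m^'n \<Rightarrow> bool" where
  "is_pseudoinverse A P \<longleftrightarrow>
     A ** P ** A = A \<and> P ** A ** P = P \<and> hermitian (A ** P) \<and> hermitian (P ** A)"

definition pseudoinverse :: "complex^'n^'m \<Rightarrow> complex^'m^'n" where
  "pseudoinverse A = (THE P. is_pseudoinverse A P)"

lemma conj_transpose_mult: "conj_transpose (A ** B) = conj_transpose B ** conj_transpose A"
  by (simp add: conj_transpose_def matrix_matrix_mult_def vec_eq_iff mult.commute)

lemma conj_transpose_conj_transpose [simp]: "conj_transpose (conj_transpose A) = A"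
  by (simp add: conj_transpose_def vec_eq_iff)

lemma is_pseudoinverse_unique:
  assumes "is_pseudoinverse A P" and "is_pseudoinverse A Q"
  shows "P = Q"
proof -
  have AP: "A ** P = A ** Q"
  proof -
    have "A ** P = conj_transpose (A ** P)"
      using assms(1) by (simp add: is_pseudoinverse_def hermitian_def)
    also have "\<dots> = conj_transpose ((A ** Q) ** (A ** P))"
      using assms(2) by (simp add: is_pseudoinverse_def matrix_mul_assoc)
    also have "\<dots> = (A ** P) ** (A ** Q)"
      using assms by (simp add: conj_transpose_mult[of "A ** Q" "A ** P"] is_pseudoinverse_def hermitian_def)
    also have "\<dots> = A ** Q"
      using assms(1) by (simp add: is_pseudoinverse_def matrix_mul_assoc)
    finally show ?thesis .
  qed
  have PA: "P ** A = Q ** A"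
  proof -
    have "P ** A = conj_transpose (P ** A)"
      using assms(1) by (simp add: is_pseudoinverse_def hermitian_def)
    also have "\<dots> = conj_transpose ((P ** A) ** (Q ** A))"
      using assms(2) by (simp add: is_pseudoinverse_def flip: matrix_mul_assoc)
    also have "\<dots> = (Q ** A) ** (P ** A)"
      using assms by (simp add: conj_transpose_mult[of "P ** A" "Q ** A"] is_pseudoinverse_def hermitian_def)
    also have "\<dots> = Q ** A"
      using assms(1) by (simp add: is_pseudoinverse_def flip: matrix_mul_assoc)
    finally show ?thesis .
  qed
  have "P = P ** (A ** P)"
    using assms(1) by (simp add: is_pseudoinverse_def matrix_mul_assoc)
  also have "\<dots> = Q ** (A ** Q)"
    unfolding AP using PA by (simp add: matrix_mul_assoc)
  also have "\<dots> = Q"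
    using assms(2) by (simp add: is_pseudoinverse_def matrix_mul_assoc)
  finally show ?thesis .
qed

lemma pseudoinverse_eqI: "is_pseudoinverse A P \<Longrightarrow> pseudoinverse A = P"
  unfolding pseudoinverse_def using is_pseudoinverse_unique by (intro the_equality) auto

lemma is_pseudoinverse_pseudoinverse_inj:
  fixes A :: "complex^'p^'n"
  assumes "inj ((*v) A)"
  shows "is_pseudoinverse A (pseudoinverse A)"
proof -
  let ?H = "conj_transpose A"
  have ker: "x = 0" if "(?H ** A) *v x = 0" for x
  proof -
    let ?y = "A *v x"
    have "0 = (\<Sum>j\<in>UNIV. cnj (x $ j) * (?H *v ?y) $ j)"
      using that by (simp add: matrix_vector_mul_assoc)
    also have "\<dots> = (\<Sum>j\<in>UNIV. \<Sum>i\<in>UNIV. cnj (A $ i $ j * x $ j) * ?y $ i)"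
      by (simp add: conj_transpose_def matrix_vector_mult_def[of "\<chi> i j. cnj (A $ j $ i)"] sum_distrib_left mult_ac)
    also have "\<dots> = (\<Sum>i\<in>UNIV. \<Sum>j\<in>UNIV. cnj (A $ i $ j * x $ j) * ?y $ i)"
      by (rule sum.swap)
    also have "\<dots> = (\<Sum>i\<in>UNIV. cnj (?y $ i) * ?y $ i)"
      by (simp add: matrix_vector_mult_def sum_distrib_right)
    also have "\<dots> = complex_of_real (\<Sum>i\<in>UNIV. (cmod (?y $ i))\<^sup>2)"
      by (simp only: of_real_sum complex_norm_square mult.commute)
    finally have "(\<Sum>i\<in>UNIV. (cmod (?y $ i))\<^sup>2) = 0"
      by (metis of_real_eq_0_iff)
    then have "?y = 0"
      by (simp add: sum_nonneg_eq_0_iff vec_eq_iff)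
    then show "x = 0"
      using assms by (metis injD matrix_vector_mult_0_right)
  qed
  then obtain G where G: "G ** (?H ** A) = mat 1"
    using matrix_left_invertible_ker[of "?H ** A"] by blast
  then have G': "(?H ** A) ** G = mat 1"
    by (simp add: matrix_left_right_inverse)
  have one: "conj_transpose (mat 1) = mat 1"
    by (simp add: conj_transpose_def mat_def vec_eq_iff)
  have "conj_transpose G ** (?H ** A) = mat 1"
    using arg_cong[OF G', of conj_transpose] by (simp add: conj_transpose_mult one)
  then have herm: "conj_transpose G = G"
    by (metis G' matrix_mul_assoc matrix_mul_lid matrix_mul_rid)
  have "is_pseudoinverse A (G ** ?H)"
    unfolding is_pseudoinverse_def hermitian_def
    using G by (simp add: conj_transpose_mult herm one flip: matrix_mul_assoc)
  then show ?thesis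
    by (metis pseudoinverse_eqI)
qed


definition tight :: "(complex^'k^'k \<Rightarrow> real) \<Rightarrow> (complex^'k^'k) set \<Rightarrow> bool" where
  "tight f F \<longleftrightarrow> (\<exists>X. {Y. is_arg_min f (\<lambda>Z. Z \<in> F) Y} = {X} \<and> rank X = 1)"

text \<open>The \<open>i\<close>-th row of \<open>A\<close> is \<open>a\<^sub>i\<^sup>*\<close>, so the column vector \<open>a\<^sub>i\<close> has conjugated entries.\<close>

definition meas_vec :: "complex^'p^'n \<Rightarrow> 'n \<Rightarrow> complex^'p" where
  "meas_vec A i = (\<chi> j. cnj (A $ i $ j))"

definition phaselift_feasible :: "complex^'p^'n \<Rightarrow> real^'n \<Rightarrow> (complex^'p^'p) set" where
  "phaselift_feasible A b =
     {X. hermitian X \<and> psd X \<and>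
         (\<forall>i. trace (outer (meas_vec A i) ** X) = complex_of_real ((b $ i)\<^sup>2))}"

text \<open>The trace of a Hermitian matrix, and of a product of two Hermitian matrices, is real, so both
  objectives are real on the feasible sets; \<open>Re\<close> only changes the type.\<close>

definition phaselift_objective :: "complex^'p^'p \<Rightarrow> real" where
  "phaselift_objective X = Re (trace X)"

definition phaselift_tight :: "complex^'p^'n \<Rightarrow> real^'n \<Rightarrow> bool" where
  "phaselift_tight A b \<longleftrightarrow> tight phaselift_objective (phaselift_feasible A b)"

definition phasecut_M :: "complex^'p^'n \<Rightarrow> real^'n \<Rightarrow> complex^'n^'n" where
  "phasecut_M A b = diag_matrix b ** (mat 1 - A ** pseudoinverse A) ** diag_matrix b"

definition phasecut_B :: "complex^'p^'n \<Rightarrow> real^'n \<Rightarrow> complex^'n^'n" where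
  "phasecut_B A b =
     diag_matrix b ** conj_transpose (pseudoinverse A) ** pseudoinverse A ** diag_matrix b"

definition phasecutmod_feasible :: "complex^'p^'n \<Rightarrow> real^'n \<Rightarrow> (complex^'n^'n) set" where
  "phasecutmod_feasible A b =
     {U. hermitian U \<and> psd U \<and> trace (phasecut_M A b ** U) = 0 \<and> (\<forall>i. U $ i $ i = 1)}"

definition phasecutmod_objective :: "complex^'p^'n \<Rightarrow> real^'n \<Rightarrow> complex^'n^'n \<Rightarrow> real" where
  "phasecutmod_objective A b U = Re (trace (phasecut_B A b ** U))"

definition phasecutmod_tight :: "complex^'p^'n \<Rightarrow> real^'n \<Rightarrow> bool" where
  "phasecutmod_tight A b \<longleftrightarrow> tight (phasecutmod_objective A b) (phasecutmod_feasible A b)"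

end

(* With D = diag(b), the maps X |-> D^-1 A X A^* D^-1 and U |-> A^+ D U D A^+^* are mutually inverse
   bijections between the two feasible sets which preserve the objective. For the second map this
   rests on the constraint Tr(M U) = 0: it says that D U D has trace zero against the projection
   1 - A A^+, and for a positive semidefinite matrix this forces D U D to vanish on the range of that
   projection. The first map preserves rank one, since the unit diagonal keeps the image nonzero. *)

theory Submission
  imports Defs
begin

section \<open>The complex inner product and positive semidefinite matrices\<close>

definition cinner :: "complex^'n \<Rightarrow> complex^'n \<Rightarrow> complex" where
  "cinner v w = (\<Sum>i\<in>UNIV. cnj (v $ i) * w $ i)"

lemma psd_iff: "psd X \<longleftrightarrow> hermitian X \<and> (\<forall>v. 0 \<le> Re (cinner v (X *v v)))"
  by (simp add: psd_def cinner_def)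

lemma cinner_diff_left: "cinner (u - v) w = cinner u w - cinner v w"
  and cinner_diff_right: "cinner w (u - v) = cinner w u - cinner w v"
  and cinner_scale_left: "cinner (c *s v) w = cnj c * cinner v w"
  and cinner_scale_right: "cinner v (c *s w) = c * cinner v w"
  by (simp_all add: cinner_def algebra_simps sum_subtractf sum_distrib_left)

lemma cinner_self: "cinner v v = complex_of_real (\<Sum>i\<in>UNIV. (cmod (v $ i))\<^sup>2)"
  by (simp only: cinner_def of_real_sum complex_norm_square mult.commute)

lemma cinner_self_eq_0: "Re (cinner v v) \<le> 0 \<Longrightarrow> v = 0"
  using sum_nonneg_eq_0_iff[of UNIV "\<lambda>i. (cmod (v $ i))\<^sup>2"]
  by (simp add: cinner_self vec_eq_iff sum_nonneg antisym)

lemma cinner_adjoint: "cinner v (C *v w) = cinner (conj_transpose C *v v) w"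
proof -
  have "cinner v (C *v w) = (\<Sum>i\<in>UNIV. \<Sum>j\<in>UNIV. cnj (v $ i) * (C $ i $ j * w $ j))"
    by (simp add: cinner_def matrix_vector_mult_def sum_distrib_left)
  also have "\<dots> = (\<Sum>j\<in>UNIV. \<Sum>i\<in>UNIV. cnj (v $ i) * (C $ i $ j * w $ j))"
    by (rule sum.swap)
  also have "\<dots> = cinner (conj_transpose C *v v) w"
    by (simp add: cinner_def matrix_vector_mult_def conj_transpose_def sum_distrib_left sum_distrib_right mult_ac)
  finally show ?thesis .
qed

lemma hermitian_congruence:
  "hermitian X \<Longrightarrow> hermitian (C ** X ** conj_transpose C)"
  by (simp add: hermitian_def conj_transpose_mult matrix_mul_assoc)

lemma psd_congruence:
  assumes "psd X"
  shows "psd (C ** X ** conj_transpose C)"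
proof -
  have "cinner v ((C ** X ** conj_transpose C) *v v)
      = cinner (conj_transpose C *v v) (X *v (conj_transpose C *v v))" for v
    by (simp add: cinner_adjoint flip: matrix_vector_mul_assoc)
  then show ?thesis
    using assms by (simp add: psd_iff hermitian_congruence)
qed

text \<open>The quadratic form at \<open>v - t X v\<close> is at most \<open>-2 t |X v|\<^sup>2 + O(t\<^sup>2)\<close>, so nonnegativity for
  small \<open>t > 0\<close> forces \<open>X v = 0\<close>.\<close>

lemma psd_isotropic:
  assumes "psd X" and "Re (cinner v (X *v v)) = 0"
  shows "X *v v = 0"
proof -
  define w where "w = X *v v"
  define a where "a = Re (cinner w w)"
  define c where "c = Re (cinner w (X *v w))"
  have herm: "conj_transpose X = X"
    using assms(1) by (simp add: psd_def hermitian_def)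
  \<comment> \<open>Moving \<open>X\<close> onto \<open>v\<close> makes both cross terms of the
    expansion in \<open>ineq\<close> multiples of the same number \<open>cinner w w\<close>.\<close>
  have vw: "cinner v (X *v w) = cinner w w"
    by (simp add: cinner_adjoint herm w_def)
  have c0: "c \<ge> 0"
    using assms(1) by (simp add: psd_iff c_def)
  have ineq: "2 * t * a \<le> t\<^sup>2 * c" for t :: real
  proof -
    let ?u = "v - complex_of_real t *s w"
    have "X *v ?u = w - complex_of_real t *s (X *v w)"
      by (simp add: w_def matrix_vector_mult_diff_distrib vec.scale)
    then have "cinner ?u (X *v ?u) = cinner v w - 2 * complex_of_real t * cinner w w
        + (complex_of_real t)\<^sup>2 * cinner w (X *v w)"
      by (simp only: cinner_diff_left cinner_diff_right cinner_scale_left cinner_scale_right vw)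
        (simp add: algebra_simps power2_eq_square)
    moreover have "(complex_of_real t)\<^sup>2 = complex_of_real (t\<^sup>2)"
      by simp
    ultimately have "Re (cinner ?u (X *v ?u)) = - 2 * t * a + t\<^sup>2 * c"
      using assms(2) by (simp add: a_def c_def w_def del: of_real_power)
    moreover have "0 \<le> Re (cinner ?u (X *v ?u))"
      using assms(1) by (simp only: psd_iff)
    ultimately show ?thesis
      by simp
  qed
  \<comment> \<open>With \<open>a = s * (c + 1)\<close> the inequality at \<open>t = s\<close>
    becomes \<open>2 * s\<^sup>2 * (c + 1) \<le> s\<^sup>2 * c\<close>, which forces
    \<open>s = 0\<close> since \<open>c + 2 > 0\<close>. The summand 1 keeps the denominator
    positive when \<open>c = 0\<close>.\<close>
  define s where "s = a / (c + 1)"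
  have a: "a = s * (c + 1)"
    using c0 by (simp add: s_def)
  have "s\<^sup>2 * (c + 2) \<le> 0"
    using ineq[of s] by (simp add: a power2_eq_square algebra_simps)
  then have "a = 0"
    using c0 by (simp add: a mult_le_0_iff)
  then show ?thesis
    using cinner_self_eq_0[of w] by (simp add: a_def w_def)
qed

section \<open>Traces against an orthogonal projection\<close>

lemma matrix_diff_ldistrib: "(A::'a::ring_1^'n^'m) ** (B - C) = A ** B - A ** C"
  by (simp add: matrix_matrix_mult_def vec_eq_iff algebra_simps sum_subtractf)

lemma matrix_diff_rdistrib: "((A::'a::ring_1^'n^'m) - B) ** C = A ** C - B ** C"
  by (simp add: matrix_matrix_mult_def vec_eq_iff algebra_simps sum_subtractf)

lemma conj_transpose_diff: "conj_transpose (A - B) = conj_transpose A - conj_transpose B"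
  by (simp add: conj_transpose_def vec_eq_iff)

lemma conj_transpose_mat_1 [simp]: "conj_transpose (mat 1) = mat 1"
  by (simp add: conj_transpose_def mat_def vec_eq_iff)

text \<open>Serves to write the trace of a congruence as a sum of quadratic forms, whose real parts
  are nonnegative for positive semidefinite \<open>V\<close>.\<close>

lemma congruence_diag:
  "(conj_transpose Q ** V ** Q) $ i $ i = cinner (column i Q) (V *v column i Q)"
  by (simp add: cinner_def conj_transpose_def matrix_matrix_mult_def matrix_vector_mult_def
      column_def sum_distrib_left sum_distrib_right mult_ac)
    (rule sum.swap)

text \<open>By cyclicity the trace equals that of \<open>Q ** V ** Q\<close>, a sum of values of the
  quadratic form of \<open>V\<close> at the columns of \<open>Q\<close>. Nonnegative terms with sum
  zero all vanish, so \<open>psd_isotropic\<close> makes \<open>V\<close> kill every column of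
  \<open>Q\<close>. Taking adjoints gives the other product.\<close>

lemma psd_trace_projection:
  assumes psd: "psd V" and Q: "hermitian Q" "Q ** Q = Q" and tr: "trace (Q ** V) = 0"
  shows "V ** Q = 0" and "Q ** V = 0"
proof -
  have Qh: "conj_transpose Q = Q"
    using Q by (simp add: hermitian_def)
  have "trace (conj_transpose Q ** V ** Q) = trace (Q ** V)"
    by (metis Qh Q(2) matrix_mul_assoc trace_mul_sym)
  then have "(\<Sum>i\<in>UNIV. Re (cinner (column i Q) (V *v column i Q))) = 0"
    using tr by (simp add: trace_def congruence_diag flip: Re_sum)
  then have "Re (cinner (column i Q) (V *v column i Q)) = 0" for i
    using psd by (subst (asm) sum_nonneg_eq_0_iff) (auto simp: psd_iff)
  then have "V *v column i Q = 0" for i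
    by (rule psd_isotropic[OF psd])
  then show VQ: "V ** Q = 0"
    by (simp add: vec_eq_iff matrix_matrix_mult_def matrix_vector_mult_def column_def)
  have "Q ** V = conj_transpose (V ** Q)"
    using psd by (simp add: conj_transpose_mult Qh psd_def hermitian_def)
  also have "\<dots> = 0"
    unfolding VQ by (simp add: conj_transpose_def vec_eq_iff)
  finally show "Q ** V = 0" .
qed

section \<open>Matrices of rank one and transfer of tightness\<close>

lemma rank_1_factor:
  fixes X :: "'a::field^'n^'m"
  assumes "rank X = 1"
  obtains x y where "\<And>i j. X $ i $ j = x $ i * y $ j"
proof -
  \<comment> \<open>The row space has a one-element basis \<open>{y}\<close>; the coefficients of
    the rows in it form the column factor \<open>x\<close>.\<close>
  obtain B where B: "rows X \<subseteq> vec.span B" "card B = 1"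
    using assms unfolding row_rank_def_gen by (metis vec.basis_exists)
  then obtain y where "B = {y}"
    by (metis card_1_singletonE)
  then have "\<forall>i. \<exists>c. row i X = c *s y"
    using B(1) by (auto simp: rows_def vec.span_singleton)
  then obtain c where c: "\<And>i. row i X = c i *s y"
    by metis
  have "X $ i $ j = (\<chi> i. c i) $ i * y $ j" for i j
    using c[of i] by (simp add: row_def vec_eq_iff)
  then show ?thesis
    by (rule that)
qed

text \<open>Writing \<open>X\<close> as a column \<open>x\<close> times a row \<open>y\<close>,
  every row of the product is a multiple of \<open>y v* D\<close>, so the rank is at most one; being
  nonzero excludes rank zero.\<close>

lemma rank_1_sandwich:
  fixes X :: "'a::field^'n^'m" and C :: "'a^'m^'k" and D :: "'a^'l^'n"
  assumes "rank X = 1" and nz: "C ** X ** D \<noteq> 0"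
  shows "rank (C ** X ** D) = 1"
proof -
  obtain x y where xy: "\<And>i j. X $ i $ j = x $ i * y $ j"
    using rank_1_factor[OF assms(1)] by blast
  have "row i (C ** X ** D) = (C *v x) $ i *s (y v* D)" for i
    by (simp add: row_def matrix_matrix_mult_def matrix_vector_mult_def vector_matrix_mult_def
        vec_eq_iff xy sum_distrib_left sum_distrib_right mult_ac)
  then have sub: "rows (C ** X ** D) \<subseteq> vec.span {y v* D}"
    by (auto simp: rows_def vec.span_singleton)
  have "rank (C ** X ** D) \<le> 1"
    unfolding row_rank_def_gen using vec.dim_le_card[OF sub] by simp
  moreover have "rank (C ** X ** D) \<noteq> 0"
  proof
    assume "rank (C ** X ** D) = 0"
    then have "rows (C ** X ** D) \<subseteq> {0}"
      by (simp add: row_rank_def_gen)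
    then have "row i (C ** X ** D) = 0" for i
      by (auto simp: rows_def)
    then have "C ** X ** D = 0"
      by (simp add: row_def vec_eq_iff)
    then show False
      using nz by simp
  qed
  ultimately show ?thesis
    by linarith
qed

text \<open>Since \<open>f (\<psi> U) = g (\<phi> (\<psi> U)) = g U\<close>, both maps preserve the
  objective. Hence \<open>\<psi>\<close> sends a minimizer \<open>U\<close> to the unique minimizer
  \<open>X\<close>, and \<open>U = \<phi> (\<psi> U) = \<phi> X\<close>. Conversely, a point of
  \<open>G\<close> better than \<open>\<phi> X\<close> would have an image under
  \<open>\<psi>\<close> better than \<open>X\<close>.\<close>

lemma tight_transfer:
  assumes "tight f F"
    and \<phi>: "\<And>X. X \<in> F \<Longrightarrow> \<phi> X \<in> G \<and> g (\<phi> X) = f X"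
    and \<psi>: "\<And>U. U \<in> G \<Longrightarrow> \<psi> U \<in> F \<and> \<phi> (\<psi> U) = U"
    and rank: "\<And>X. X \<in> F \<Longrightarrow> rank X = 1 \<Longrightarrow> rank (\<phi> X) = 1"
  shows "tight g G"
proof -
  obtain X where X: "{Y. is_arg_min f (\<lambda>Z. Z \<in> F) Y} = {X}" and rX: "rank X = 1"
    using assms(1) by (auto simp: tight_def)
  have arg: "is_arg_min f (\<lambda>Z. Z \<in> F) Y \<longleftrightarrow> Y = X" for Y
    using X by blast
  then have XF: "X \<in> F"
    by (auto simp: is_arg_min_def)
  have g\<psi>: "f (\<psi> U) = g U" if "U \<in> G" for U
    using \<phi> \<psi> that by metis
  have "is_arg_min g (\<lambda>Z. Z \<in> G) U \<longleftrightarrow> U = \<phi> X" for U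
  proof
    assume U: "is_arg_min g (\<lambda>Z. Z \<in> G) U"
    then have "is_arg_min f (\<lambda>Z. Z \<in> F) (\<psi> U)"
      using \<phi> \<psi> g\<psi> unfolding is_arg_min_def by metis
    then show "U = \<phi> X"
      using U \<psi> arg by (metis is_arg_min_def)
  next
    assume "U = \<phi> X"
    then show "is_arg_min g (\<lambda>Z. Z \<in> G) U"
      using arg[of X] \<phi> \<psi> g\<psi> unfolding is_arg_min_def by metis
  qed
  then show ?thesis
    using rank[OF XF rX] by (auto simp: tight_def)
qed

section \<open>Measurements, pseudoinverses and diagonal matrices\<close>

lemma trace_outer_meas_vec:
  "trace (outer (meas_vec A i) ** X) = (A ** X ** conj_transpose A) $ i $ i"
  by (simp add: trace_def outer_def meas_vec_def conj_transpose_def matrix_matrix_mult_def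
      sum_distrib_left sum_distrib_right mult_ac)

text \<open>The first Penrose equation says that \<open>A\<close> agrees after composition with
  \<open>pseudoinverse A ** A\<close>, and injectivity cancels the outer \<open>A\<close>.\<close>

lemma pseudoinverse_left_inverse:
  fixes A :: "complex^'p^'n"
  assumes "inj ((*v) A)"
  shows "pseudoinverse A ** A = mat 1"
proof -
  have "A *v ((pseudoinverse A ** A) *v x) = A *v x" for x
    using is_pseudoinverse_pseudoinverse_inj[OF assms]
    by (simp add: is_pseudoinverse_def matrix_vector_mul_assoc matrix_mul_assoc)
  then show ?thesis
    using assms by (simp add: matrix_eq injD)
qed

lemma conj_transpose_diag_matrix [simp]: "conj_transpose (diag_matrix b) = diag_matrix b"
  by (simp add: conj_transpose_def diag_matrix_def vec_eq_iff)

lemma diag_matrix_mult_left: "(diag_matrix b ** V) $ i $ j = complex_of_real (b $ i) * V $ i $ j"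
proof -
  have "(diag_matrix b ** V) $ i $ j = (\<Sum>k\<in>UNIV. if i = k then complex_of_real (b $ i) * V $ k $ j else 0)"
    by (simp only: matrix_matrix_mult_def vec_lambda_beta)
      (rule sum.cong, auto simp: diag_matrix_def)
  then show ?thesis
    by simp
qed

lemma diag_matrix_mult_right: "(V ** diag_matrix b) $ i $ j = V $ i $ j * complex_of_real (b $ j)"
proof -
  have "(V ** diag_matrix b) $ i $ j = (\<Sum>k\<in>UNIV. if k = j then V $ i $ k * complex_of_real (b $ k) else 0)"
    by (simp only: matrix_matrix_mult_def vec_lambda_beta)
      (rule sum.cong, auto simp: diag_matrix_def)
  then show ?thesis
    by simp
qed

lemma diag_matrix_inverse:
  assumes "\<forall>i. b $ i \<noteq> 0"
  shows "diag_matrix b ** diag_matrix (\<chi> i. inverse (b $ i)) = mat 1"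
    and "diag_matrix (\<chi> i. inverse (b $ i)) ** diag_matrix b = mat 1"
  using assms
  by (simp_all add: vec_eq_iff diag_matrix_mult_left) (simp_all add: diag_matrix_def mat_def)

section \<open>The correspondence between the two programs\<close>

theorem corollary4p3:
  fixes A :: "complex^'p^'n" and b :: "real^'n"
  assumes "inj ((*v) A)"
    and "\<forall>i. b $ i \<noteq> 0"
    and "\<exists>x. \<forall>i. cmod ((A *v x) $ i) = b $ i"
    and "phaselift_tight A b"
  shows "phasecutmod_tight A b"
proof -
  define P where "P = pseudoinverse A"
  define D where "D = diag_matrix b"
  define E where "E = diag_matrix (\<chi> i. inverse (b $ i))"
  \<comment> \<open>The orthogonal projection onto the complement of the range of \<open>A\<close>;
    the matrix M of the constraint is \<open>D ** Q ** D\<close>.\<close>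
  define Q where "Q = mat 1 - A ** P"
  define \<phi> where "\<phi> X = E ** (A ** X ** conj_transpose A) ** E" for X
  define \<psi> where "\<psi> U = P ** (D ** U ** D) ** conj_transpose P" for U
  have DE: "D ** E = mat 1" and ED: "E ** D = mat 1"
    using diag_matrix_inverse[OF assms(2)] by (simp_all add: D_def E_def)
  have Dh: "conj_transpose D = D" and Eh: "conj_transpose E = E"
    by (simp_all add: D_def E_def)
  have PA: "P ** A = mat 1"
    using pseudoinverse_left_inverse[OF assms(1)] by (simp add: P_def)
  have APh: "conj_transpose (A ** P) = A ** P"
    using is_pseudoinverse_pseudoinverse_inj[OF assms(1)]
    by (simp add: is_pseudoinverse_def hermitian_def P_def)
  have APA: "A ** P ** A = A"
    by (simp add: PA flip: matrix_mul_assoc)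
  have QA: "Q ** A = 0"
    by (simp add: Q_def matrix_diff_rdistrib APA)
  have Qh: "hermitian Q"
    by (simp add: hermitian_def Q_def conj_transpose_diff APh)
  have QQ: "Q ** Q = Q"
    using QA by (simp add: Q_def matrix_diff_ldistrib matrix_mul_assoc)
  \<comment> \<open>Cyclicity moves the outer \<open>D\<close> onto \<open>U\<close>, so the
    constraint takes the form required by \<open>psd_trace_projection\<close>.\<close>
  have trM: "trace (phasecut_M A b ** U) = trace (Q ** (D ** U ** D))" for U
    unfolding phasecut_M_def Q_def[unfolded P_def, symmetric] D_def[symmetric]
    using trace_mul_sym[of D "Q ** D ** U"] by (simp add: matrix_mul_assoc)
  \<comment> \<open>The PhaseCutMod objective at \<open>U\<close> is thus the PhaseLift objective at
    \<open>\<psi> U\<close>.\<close>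
  have trB: "trace (phasecut_B A b ** U) = trace (\<psi> U)" for U
    unfolding phasecut_B_def P_def[symmetric] D_def[symmetric] \<psi>_def
    using trace_mul_sym[of "D ** conj_transpose P" "P ** D ** U"] by (simp add: matrix_mul_assoc)
  have D\<phi>: "D ** \<phi> X ** D = A ** X ** conj_transpose A" for X
  proof -
    have "D ** \<phi> X ** D = (D ** E) ** (A ** X ** conj_transpose A) ** (E ** D)"
      by (simp add: \<phi>_def matrix_mul_assoc)
    then show ?thesis
      by (simp add: DE ED)
  qed
  have PAc: "conj_transpose A ** conj_transpose P = mat 1"
    using arg_cong[OF PA, of conj_transpose] by (simp add: conj_transpose_mult)
  \<comment> \<open>Together with \<open>trB\<close> this shows that \<open>\<phi>\<close> preserves
    the objective.\<close>
  have \<psi>\<phi>: "\<psi> (\<phi> X) = X" for X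
  proof -
    have "\<psi> (\<phi> X) = (P ** A) ** X ** (conj_transpose A ** conj_transpose P)"
      unfolding \<psi>_def D\<phi> by (simp add: matrix_mul_assoc)
    then show ?thesis
      by (simp add: PA PAc)
  qed
  have A\<psi>: "A ** \<psi> U ** conj_transpose A = D ** U ** D"
    if "psd U" "trace (phasecut_M A b ** U) = 0" for U
  proof -
    let ?V = "D ** U ** D"
    have "psd ?V"
      using psd_congruence[OF that(1), of D] by (simp add: Dh)
    then have "?V ** Q = 0" "Q ** ?V = 0"
      using psd_trace_projection[of ?V Q] Qh QQ that(2) by (simp_all add: trM)
    then have V: "?V = ?V ** (A ** P)" "?V = A ** P ** ?V"
      by (simp_all add: Q_def matrix_diff_ldistrib matrix_diff_rdistrib)
    \<comment> \<open>Both outer factors are the projection \<open>A ** P\<close>, which fixes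
      \<open>?V\<close> from either side because \<open>Q\<close> annihilates it.\<close>
    have "A ** \<psi> U ** conj_transpose A = (A ** P) ** ?V ** conj_transpose (A ** P)"
      by (simp add: \<psi>_def conj_transpose_mult matrix_mul_assoc)
    also have "\<dots> = ?V"
      unfolding APh by (simp flip: V)
    finally show ?thesis .
  qed
  have "tight (phasecutmod_objective A b) (phasecutmod_feasible A b)"
  proof (rule tight_transfer)
    show "tight phaselift_objective (phaselift_feasible A b)"
      using assms(4) by (simp add: phaselift_tight_def)
  next
    fix X
    assume X: "X \<in> phaselift_feasible A b"
    then have psd: "psd (\<phi> X)"
      using psd_congruence[of X "E ** A"]
      by (simp add: phaselift_feasible_def \<phi>_def conj_transpose_mult Eh matrix_mul_assoc)
    \<comment> \<open>The measurement of \<open>X\<close> against the i-th row is the i-th diagonal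
      entry here; \<open>E\<close> on both sides then rescales it to 1.\<close>
    have "(A ** X ** conj_transpose A) $ i $ i = complex_of_real ((b $ i)\<^sup>2)" for i
      using X by (simp add: phaselift_feasible_def trace_outer_meas_vec)
    then have diag: "\<phi> X $ i $ i = 1" for i
      using assms(2) by (simp add: \<phi>_def E_def diag_matrix_mult_left diag_matrix_mult_right power2_eq_square field_simps)
    \<comment> \<open>By \<open>D\<phi>\<close> the trace is that of
      \<open>Q ** A ** X ** conj_transpose A\<close>, and \<open>Q\<close> kills the range of
      \<open>A\<close>.\<close>
    have "trace (phasecut_M A b ** \<phi> X) = 0"
      by (simp add: trM D\<phi> matrix_mul_assoc QA) (simp add: trace_def)
    then show "\<phi> X \<in> phasecutmod_feasible A b \<and>
        phasecutmod_objective A b (\<phi> X) = phaselift_objective X"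
      using psd diag by (simp add: phasecutmod_feasible_def psd_def phasecutmod_objective_def
          phaselift_objective_def trB \<psi>\<phi>)
    assume "rank X = 1"
    moreover have "\<phi> X \<noteq> 0"
      using diag by (metis zero_index zero_neq_one)
    ultimately show "rank (\<phi> X) = 1"
      using rank_1_sandwich[of X "E ** A" "conj_transpose A ** E"]
      by (simp add: \<phi>_def matrix_mul_assoc)
  next
    fix U
    assume U: "U \<in> phasecutmod_feasible A b"
    then have AU: "A ** \<psi> U ** conj_transpose A = D ** U ** D"
      by (intro A\<psi>) (simp_all add: phasecutmod_feasible_def)
    have psd: "psd (\<psi> U)"
      using U psd_congruence[of U "P ** D"]
      by (simp add: phasecutmod_feasible_def \<psi>_def conj_transpose_mult Dh matrix_mul_assoc)
    have "\<phi> (\<psi> U) = (E ** D) ** U ** (D ** E)"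
      unfolding \<phi>_def AU by (simp add: matrix_mul_assoc)
    then have "\<phi> (\<psi> U) = U"
      by (simp add: DE ED)
    \<comment> \<open>By \<open>AU\<close> the measurements of \<open>\<psi> U\<close> are the
      diagonal entries of \<open>D ** U ** D\<close>, which the unit diagonal of \<open>U\<close>
      makes the squares of the \<open>b $ i\<close>.\<close>
    moreover have "\<psi> U \<in> phaselift_feasible A b"
      using U psd
      by (simp add: phaselift_feasible_def phasecutmod_feasible_def trace_outer_meas_vec AU
          D_def diag_matrix_mult_left diag_matrix_mult_right psd_def power2_eq_square)
    ultimately show "\<psi> U \<in> phaselift_feasible A b \<and> \<phi> (\<psi> U) = U"
      by simp
  qed
  then show ?thesis
    by (simp add: phasecutmod_tight_def)
qed

end
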